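(* Let $R_1$ and $R_2$ be fibrous posets with edges colored by a set $I$, let $J\subseteq I$, and let $\nu=(\nu_j)_{j\in J}$ be a $J$-tuple of nonnegative integers. Let $R$ be any disjoint sum of connected components of $R_1\otimes R_2$, where $R_2$ is a primary poset. Suppose $\kappa^{(1)}:R_1\setminus\mathcal M_{J,\nu}(R_1)\to J$ is a $(J,\nu)$-coloring function on $R_1$. For any $(\mathbf x_1,\mathbf x_2)\in R\setminus\mathcal M_{J,\nu}(R)$, exactly one of the following three conditions holds, and $\kappa(\mathbf x_1,\mathbf x_2)$ is declared accordingly: (i) if $\mathbf x_1\notin\mathcal M_{J,\nu}(R_1)$, then $\kappa(\mathbf x_1,\mathbf x_2)=\kappa^{(1)}(\mathbf x_1)$; (ii) if $\mathbf x_1\in\mathcal M_{J,\nu}(R_1)$ and there is a unique color $j\in\mathcal K_{J,\nu}(\mathbf x_1,\mathbf x_2)$ such that $\max\{\rho_j(\mathbf x_2),\,l_j(\mathbf x_2)-\rho_j(\mathbf x_1)\}\ge2$, then $\kappa(\mathbf x_1,\mathbf x_2)=j$; (iii) if $\mathbf x_1\in\mathcal M_{J,\nu}(R_1)$ and for all $i\in\mathcal K_{J,\nu}(\mathbf x_1,\mathbf x_2)$ we have $\max\{\rho_i(\mathbf x_2),\,l_i(\mathbf x_2)-\rho_i(\mathbf x_1)\}\le1$, then $\kappa(\mathbf x_1,\mathbf x_2)=k$, where $k$ is a color freely chosen from $\mathcal K_{J,\nu}(\mathbf x_1,\mathbf x_2)$. Then $\kappa:R\setminus\mathcal M_{J,\nu}(R)\to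 J$ is a $(J,\nu)$-coloring of $R$.
   Context: All posets are finite, identified with Hasse diagrams (edge $\mathbf s\to\mathbf t$ iff $\mathbf t$ covers $\mathbf s$). Ranked means there is a surjection $\rho:R\to\{0,\dots,l\}$ with $\rho(\mathbf s)+1=\rho(\mathbf t)$ whenever $\mathbf s\to\mathbf t$; $l$ is the length. For a ranked poset $R$ with Hasse edges colored by $I$, $\mathrm{comp}_i(\mathbf x)$ is the connected component of $\mathbf x$ using only color $i$ edges; $\rho_i(\mathbf x)$ is the rank of $\mathbf x$ there, $l_i(\mathbf x)$ its length, $\delta_i=l_i-\rho_i$. $R$ is fibrous if every $\mathrm{comp}_i(\mathbf x)$ is a chain. Crystal product: for fibrous $R_1,R_2$, $R_1\otimes R_2$ has vertex set $R_1\times R_2$ with $(\mathbf x_1,\mathbf x_2)\xrightarrow{i}(\mathbf y_1,\mathbf y_2)$ iff either (1) $\mathbf x_1\xrightarrow{i}\mathbf y_1$, $\mathbf x_2=\mathbf y_2$ and $\rho_i(\mathbf x_1)\ge\delta_i(\mathbf x_2)$, or (2) $\mathbf x_1=\mathbf y_1$, $\mathbf x_2\xrightarrow{i}\mathbf y_2$ and $\rho_i(\mathbf x_1)<\delta_i(\mathbf x_2)$. This is the Hasse diagram of a fibrous ranked poset. Primary: a fibrous poset such that whenever $\mathrm{comp}_i(\mathbf x)$ is a chain $\mathbf x_0\xrightarrow{i}\mathbf x_1\xrightarrow{i}\cdots\xrightarrow{i}\mathbf x_\ell$ with $\ell\ge2$, then for all $j\ne i$ and $0\le k\le\ell-1$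 we have $\delta_j(\mathbf x_k)=0$ if $l_j(\mathbf x_k)\ge2$. For fibrous $R$: $\mathcal M_{J,\nu}(R)=\{\mathbf m\in R:\delta_j(\mathbf m)\le\nu_j\ \forall j\in J\}$ and $\mathcal K_{J,\nu}(\mathbf x)=\{j\in J:\delta_j(\mathbf x)>\nu_j\}$. For an integer $p\ge0$, $U_i(\mathbf x,p)$ is the set of the topmost $1+p$ elements of the chain $\mathrm{comp}_i(\mathbf x)$ (all of it if it has fewer than $1+p$ elements). A $(J,\nu)$-coloring of $R$ is a function $\kappa:R\setminus\mathcal M_{J,\nu}(R)\to J$ such that for all $\mathbf x\in R\setminus\mathcal M_{J,\nu}(R)$, with $j=\kappa(\mathbf x)$, $\{\mathbf y\in\mathrm{comp}_j(\mathbf x):\mathbf y\notin\mathcal M_{J,\nu}(R),\ \kappa(\mathbf y)=j\}=\mathrm{comp}_j(\mathbf x)\setminus U_j(\mathbf x,\nu_j)$. *)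

theory Defs
  imports Main
begin

text \<open>
  A finite poset with edge-colored Hasse diagram is given by its vertices and its colored edges;
  a triple \<open>(s, i, t)\<close> is an edge of color \<open>i\<close> from \<open>s\<close> up to \<open>t\<close>.
\<close>

record ('a, 'i) cposet =
  verts :: "'a set"
  edges :: "('a \<times> 'i \<times> 'a) set"

definition arcs :: "('a, 'i) cposet \<Rightarrow> ('a \<times> 'a) set" where
  "arcs R = {(s, t). \<exists>i. (s, i, t) \<in> edges R}"

definition le :: "('a, 'i) cposet \<Rightarrow> ('a \<times> 'a) set" where
  "le R = (arcs R)\<^sup>* \<inter> verts R \<times> verts R"

definition covers :: "('a \<times> 'a) set \<Rightarrow> ('a \<times> 'a) set" where
  "covers r = {(s, t). (s, t) \<in> r \<and> s \<noteq> t \<and>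
     \<not> (\<exists>u. u \<noteq> s \<and> u \<noteq> t \<and> (s, u) \<in> r \<and> (u, t) \<in> r)}"

definition colored_poset :: "'i set \<Rightarrow> ('a, 'i) cposet \<Rightarrow> bool" where
  "colored_poset I R \<longleftrightarrow>
     finite (verts R) \<and>
     edges R \<subseteq> verts R \<times> I \<times> verts R \<and>
     (\<forall>s t i j. (s, i, t) \<in> edges R \<longrightarrow> (s, j, t) \<in> edges R \<longrightarrow> i = j) \<and>
     partial_order_on (verts R) (le R) \<and>
     arcs R = covers (le R)"

definition rank_function :: "('a, 'i) cposet \<Rightarrow> ('a \<Rightarrow> nat) \<Rightarrow> nat \<Rightarrow> bool" where
  "rank_function R \<rho> l \<longleftrightarrow>
     \<rho> ` verts R = {0..l} \<and> (\<forall>(s, t) \<in> arcs R. \<rho> s + 1 = \<rho> t)"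

definition ranked :: "('a, 'i) cposet \<Rightarrow> bool" where
  "ranked R \<longleftrightarrow> (\<exists>\<rho> l. rank_function R \<rho> l)"

definition component :: "('a, 'i) cposet \<Rightarrow> 'a \<Rightarrow> ('a, 'i) cposet" where
  "component R x =
     (let C = {y \<in> verts R. (x, y) \<in> (arcs R \<union> (arcs R)\<inverse>)\<^sup>*}
      in \<lparr>verts = C, edges = {(s, i, t) \<in> edges R. s \<in> C \<and> t \<in> C}\<rparr>)"

definition components :: "('a, 'i) cposet \<Rightarrow> ('a, 'i) cposet set" where
  "components R = component R ` verts R"

text \<open>Used only for distinct connected components of one poset, whose vertex sets are disjoint.\<close>

definition disjoint_sum :: "('a, 'i) cposet set \<Rightarrow> ('a, 'i) cposet" where
  "disjoint_sum \<C> = \<lparr>verts = \<Union> (verts ` \<C>), edges = \<Union> (edges ` \<C>)\<rparr>"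

definition comp :: "('a, 'i) cposet \<Rightarrow> 'i \<Rightarrow> 'a \<Rightarrow> ('a, 'i) cposet" where
  "comp R i x =
     component \<lparr>verts = verts R, edges = {(s, j, t) \<in> edges R. j = i}\<rparr> x"

text \<open>
  In a connected ranked poset the rank function and the length are unique, which justifies the
  definite descriptions; the values of a rank function off the vertex set are arbitrary,
  so it is the value at \<open>x\<close> that is described.
\<close>

definition rk :: "('a, 'i) cposet \<Rightarrow> 'i \<Rightarrow> 'a \<Rightarrow> nat" where
  "rk R i x = (THE n. \<exists>\<rho> l. rank_function (comp R i x) \<rho> l \<and> \<rho> x = n)"

definition len :: "('a, 'i) cposet \<Rightarrow> 'i \<Rightarrow> 'a \<Rightarrow> nat" where
  "len R i x = (THE l. \<exists>\<rho>. rank_function (comp R i x) \<rho> l)"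

definition depth :: "('a, 'i) cposet \<Rightarrow> 'i \<Rightarrow> 'a \<Rightarrow> nat" where
  "depth R i x = len R i x - rk R i x"

definition fibrous :: "'i set \<Rightarrow> ('a, 'i) cposet \<Rightarrow> bool" where
  "fibrous I R \<longleftrightarrow>
     colored_poset I R \<and> ranked R \<and>
     (\<forall>i \<in> I. \<forall>x \<in> verts R. linear_order_on (verts (comp R i x)) (le (comp R i x)))"

definition crystal_product ::
  "('a, 'i) cposet \<Rightarrow> ('b, 'i) cposet \<Rightarrow> ('a \<times> 'b, 'i) cposet" where
  "crystal_product R1 R2 =
     \<lparr>verts = verts R1 \<times> verts R2,
      edges =
        {((x1, x2), i, (y1, y2)) | x1 x2 i y1 y2.
           ((x1, i, y1) \<in> edges R1 \<and> x2 \<in> verts R2 \<and> x2 = y2 \<and> rk R1 i x1 \<ge> depth R2 i x2) \<or>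
           (x1 \<in> verts R1 \<and> x1 = y1 \<and> (x2, i, y2) \<in> edges R2 \<and> rk R1 i x1 < depth R2 i x2)}\<rparr>"

definition primary :: "'i set \<Rightarrow> ('a, 'i) cposet \<Rightarrow> bool" where
  "primary I R \<longleftrightarrow>
     fibrous I R \<and>
     (\<forall>i \<in> I. \<forall>x \<in> verts R. \<forall>c l.
        comp R i x = \<lparr>verts = c ` {0..l}, edges = {(c k, i, c (Suc k)) | k. k < l}\<rparr> \<longrightarrow>
        2 \<le> l \<longrightarrow>
        (\<forall>j \<in> I. j \<noteq> i \<longrightarrow> (\<forall>k \<le> l - 1. 2 \<le> len R j (c k) \<longrightarrow> depth R j (c k) = 0)))"

definition \<M> :: "'i set \<Rightarrow> ('i \<Rightarrow> nat) \<Rightarrow> ('a, 'i) cposet \<Rightarrow> 'a set" where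
  "\<M> J \<nu> R = {m \<in> verts R. \<forall>j \<in> J. depth R j m \<le> \<nu> j}"

definition \<K> :: "'i set \<Rightarrow> ('i \<Rightarrow> nat) \<Rightarrow> ('a, 'i) cposet \<Rightarrow> 'a \<Rightarrow> 'i set" where
  "\<K> J \<nu> R x = {j \<in> J. depth R j x > \<nu> j}"

text \<open>
  The topmost \<open>1 + p\<close> elements of the chain \<open>comp R i x\<close>: those with at most \<open>p\<close> elements
  of the chain strictly above them.
\<close>

definition topmost :: "('a, 'i) cposet \<Rightarrow> 'i \<Rightarrow> 'a \<Rightarrow> nat \<Rightarrow> 'a set" where
  "topmost R i x p =
     {y \<in> verts (comp R i x). card {z. (y, z) \<in> le (comp R i x) \<and> z \<noteq> y} < 1 + p}"

text \<open>Only the values of \<open>\<kappa>\<close> on \<open>verts R - \<M> J \<nu> R\<close> and of \<open>\<nu>\<close> on \<open>J\<close> matter.\<close>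

definition coloring ::
  "'i set \<Rightarrow> ('i \<Rightarrow> nat) \<Rightarrow> ('a, 'i) cposet \<Rightarrow> ('a \<Rightarrow> 'i) \<Rightarrow> bool" where
  "coloring J \<nu> R \<kappa> \<longleftrightarrow>
     (\<forall>x \<in> verts R - \<M> J \<nu> R.
        \<kappa> x \<in> J \<and>
        {y \<in> verts (comp R (\<kappa> x) x). y \<notin> \<M> J \<nu> R \<and> \<kappa> y = \<kappa> x} =
          verts (comp R (\<kappa> x) x) - topmost R (\<kappa> x) x (\<nu> (\<kappa> x)))"

text \<open>
  \<open>max {\<rho>\<^sub>j(x2), l\<^sub>j(x2) - \<rho>\<^sub>j(x1)}\<close>; the difference may be negative.
\<close>

definition reach ::
  "('a, 'i) cposet \<Rightarrow> ('b, 'i) cposet \<Rightarrow> 'a \<Rightarrow> 'b \<Rightarrow> 'i \<Rightarrow> int" where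
  "reach R1 R2 x1 x2 j = max (int (rk R2 j x2)) (int (len R2 j x2) - int (rk R1 j x1))"

end

theory Submission
  imports Defs
begin

text \<open>
  In the product the depth of \<open>(x1, x2)\<close> in color \<open>i\<close> is
  \<open>\<delta>\<^sub>i(x1) + max {0, \<delta>\<^sub>i(x2) - \<rho>\<^sub>i(x1)}\<close>, and the first coordinate moves along an \<open>i\<close>-string only
  where the second summand vanishes. If \<open>x1\<close> is not in \<open>\<M>\<close>, the coloring condition is therefore
  inherited from \<open>R1\<close>. If \<open>x1\<close> is in \<open>\<M>\<close>, the vertices of the string of depth above \<open>\<nu>\<^sub>i\<close> all have first coordinate
  \<open>x1\<close>; for \<open>i\<close> in \<open>\<K>\<close> the condition \<open>reach \<ge> 2\<close> is constant on them, primarity leaves at most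
  one color satisfying it, and a string with \<open>reach \<le> 1\<close> contains only one such vertex.
\<close>

section \<open>Color strings as indexed chains\<close>

text \<open>The last clause makes the chain a whole color-\<open>i\<close> component and not just a
  segment of one. Rank, length and depth then become arithmetic on the indices of
  \<open>c\<close>.\<close>

definition color_string :: "('a, 'i) cposet \<Rightarrow> 'i \<Rightarrow> (nat \<Rightarrow> 'a) \<Rightarrow> nat \<Rightarrow> bool" where
  "color_string R i c l \<longleftrightarrow>
     inj_on c {0..l} \<and> c ` {0..l} \<subseteq> verts R \<and>
     (\<forall>k<l. (c k, i, c (Suc k)) \<in> edges R) \<and>
     (\<forall>s t. (s, i, t) \<in> edges R \<longrightarrow> s \<in> c ` {0..l} \<or> t \<in> c ` {0..l} \<longrightarrow>
        (\<exists>k<l. s = c k \<and> t = c (Suc k)))"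

lemma rtrancl_path:
  assumes "\<forall>k<l. (c k, c (Suc k)) \<in> r" and "j \<le> k" and "k \<le> (l::nat)"
  shows "(c j, c k) \<in> r\<^sup>*"
  using assms(2,3)
proof (induction k rule: dec_induct)
  case (step k)
  then have "(c k, c (Suc k)) \<in> r" using assms(1) by simp
  with step show ?case by (meson Suc_leD rtrancl.rtrancl_into_rtrancl)
qed simp

text \<open>The edges of the chain connect all its vertices, and by closedness no undirected walk in
  color \<open>i\<close> leaves it.\<close>

lemma comp_string:
  assumes S: "color_string R i c l" and k: "k \<le> l"
  shows "comp R i (c k) =
    \<lparr>verts = c ` {0..l}, edges = {(c k, i, c (Suc k)) | k. k < l}\<rparr>"
proof -
  define Q where "Q = \<lparr>verts = verts R, edges = {(s, j, t) \<in> edges R. j = i}\<rparr>"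
  define r where "r = arcs Q \<union> (arcs Q)\<inverse>"
  have arcs: "(s, t) \<in> arcs Q \<longleftrightarrow> (s, i, t) \<in> edges R" for s t
    by (auto simp: arcs_def Q_def)
  have edge: "\<forall>k<l. (c k, i, c (Suc k)) \<in> edges R"
    and closed: "\<And>s t. (s, i, t) \<in> edges R \<Longrightarrow> s \<in> c ` {0..l} \<or> t \<in> c ` {0..l} \<Longrightarrow>
        \<exists>k<l. s = c k \<and> t = c (Suc k)"
    and V: "c ` {0..l} \<subseteq> verts R"
    using S unfolding color_string_def by blast+
  have path: "(c a, c b) \<in> r\<^sup>*" if "a \<le> l" "b \<le> l" for a b
  proof -
    have "\<forall>k<l. (c k, c (Suc k)) \<in> r" using edge arcs by (simp add: r_def)
    then have "(c (min a b), c (max a b)) \<in> r\<^sup>*" using that by (intro rtrancl_path) auto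
    moreover have "sym (r\<^sup>*)" by (intro sym_rtrancl) (auto simp: r_def sym_def)
    ultimately show ?thesis by (cases "a \<le> b") (auto simp: min_def max_def dest: symD)
  qed
  have "y \<in> c ` {0..l}" if "(c k, y) \<in> r\<^sup>*" for y
    using that
  proof induction
    case base then show ?case using k by simp
  next
    case (step y z)
    then have "(y, i, z) \<in> edges R \<or> (z, i, y) \<in> edges R" by (auto simp: r_def arcs)
    with step.IH obtain m where "m < l" "z = c m \<or> z = c (Suc m)" using closed by blast
    then show ?case by auto
  qed
  with path k V have C: "{y \<in> verts Q. (c k, y) \<in> r\<^sup>*} = c ` {0..l}"
    by (auto simp: Q_def)
  have "{(s, j, t) \<in> edges Q. s \<in> c ` {0..l} \<and> t \<in> c ` {0..l}} =
      {(c k, i, c (Suc k)) | k. k < l}"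
    using edge closed by (fastforce simp: Q_def)
  then show ?thesis
    using C unfolding comp_def component_def Q_def[symmetric] r_def by (simp add: Let_def)
qed

lemma arcs_chain:
  "arcs \<lparr>verts = V, edges = {(c k, i, c (Suc k)) | k. k < l}\<rparr> = {(c k, c (Suc k)) | k. k < l}"
  by (auto simp: arcs_def)

text \<open>A rank function rises by one per edge, so it is fixed by its value at
  \<open>c 0\<close>; surjectivity onto \<open>{0..m}\<close> makes that value \<open>0\<close>.
  This uniqueness lets the definite descriptions in \<open>rk\<close> and \<open>len\<close> be
  evaluated.\<close>

lemma rank_function_chain:
  fixes i :: 'i
  assumes "inj_on c {0..l}"
  defines "Q \<equiv> \<lparr>verts = c ` {0..l}, edges = {(c k, i, c (Suc k)) | k. k < l}\<rparr>"
  shows "rank_function Q \<rho> m \<longleftrightarrow> m = l \<and> (\<forall>k\<le>l. \<rho> (c k) = k)"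
proof
  assume "rank_function Q \<rho> m"
  then have im: "\<rho> ` c ` {0..l} = {0..m}" and st: "\<And>k. k < l \<Longrightarrow> \<rho> (c (Suc k)) = Suc (\<rho> (c k))"
    unfolding rank_function_def Q_def arcs_chain by fastforce+
  have r: "k \<le> l \<Longrightarrow> \<rho> (c k) = \<rho> (c 0) + k" for k
    by (induction k) (auto simp: st)
  obtain a where "a \<le> l" "\<rho> (c a) = 0" using im by (force simp: set_eq_iff image_iff)
  with r have r0: "\<And>k. k \<le> l \<Longrightarrow> \<rho> (c k) = k" by (metis add_is_0 add_0)
  then have "\<rho> ` c ` {0..l} = {0..l}" by (force simp: image_iff)
  with im have "m = l" by simp
  with r0 show "m = l \<and> (\<forall>k\<le>l. \<rho> (c k) = k)" by simp
next
  assume "m = l \<and> (\<forall>k\<le>l. \<rho> (c k) = k)"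
  then show "rank_function Q \<rho> m"
    unfolding rank_function_def Q_def arcs_chain by (force simp: image_iff)
qed

lemma string_rk_len:
  assumes S: "color_string R i c l" and k: "k \<le> l"
  shows "rk R i (c k) = k" and "len R i (c k) = l" and "depth R i (c k) = l - k"
proof -
  have inj: "inj_on c {0..l}" using S by (simp add: color_string_def)
  \<comment> \<open>The inverse of the indexing is a rank function, so the descriptions denote
    something.\<close>
  have "\<forall>j\<le>l. inv_into {0..l} c (c j) = j" using inj by simp
  then have ex: "\<exists>\<rho>. \<forall>j\<le>l. \<rho> (c j) = j" by blast
  show "rk R i (c k) = k"
    unfolding rk_def comp_string[OF S k] rank_function_chain[OF inj]
    using ex k by (intro the_equality) auto
  moreover show "len R i (c k) = l"
    unfolding len_def comp_string[OF S k] rank_function_chain[OF inj]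
    using ex by (intro the_equality) auto
  ultimately show "depth R i (c k) = l - k" by (simp add: depth_def)
qed

lemma string_verts:
  assumes "color_string R i c l" and "k \<le> l"
  shows "verts (comp R i (c k)) = c ` {0..l}"
  by (simp add: comp_string[OF assms])

lemma string_le:
  assumes S: "color_string R i c l" and k: "k \<le> l"
  shows "le (comp R i (c k)) = {(c a, c b) | a b. a \<le> b \<and> b \<le> l}"
proof -
  define r where "r = {(c k, c (Suc k)) | k. k < l}"
  have inj: "inj_on c {0..l}" using S by (simp add: color_string_def)
  have up: "\<exists>b\<ge>a. b \<le> l \<and> y = c b" if "(c a, y) \<in> r\<^sup>*" "a \<le> l" for a y
    using that(1)
  proof induction
    case base then show ?case using that by blast
  next
    case (step y z)
    then obtain b m where "a \<le> b" "b \<le> l" "y = c b" "m < l" "y = c m" "z = c (Suc m)"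
      by (auto simp: r_def)
    moreover from this have "b = m" using inj by (auto simp: inj_on_def)
    ultimately show ?case by (intro exI[of _ "Suc m"]) auto
  qed
  have "(c a, c b) \<in> r\<^sup>*" if "a \<le> b" "b \<le> l" for a b
    using that by (intro rtrancl_path) (auto simp: r_def)
  then show ?thesis
    unfolding comp_string[OF S k] le_def arcs_chain r_def[symmetric]
    using up by fastforce
qed

text \<open>Strictly above \<open>c a\<close> lie exactly the vertices with indices
  \<open>Suc a\<close> to \<open>l\<close>, so the count in \<open>topmost\<close> is the depth
  \<open>l - a\<close>.\<close>

lemma string_topmost:
  assumes S: "color_string R i c l" and k: "k \<le> l"
  shows "topmost R i (c k) p = {y \<in> c ` {0..l}. depth R i y \<le> p}"
proof -
  have inj: "inj_on c {0..l}" using S by (simp add: color_string_def)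
  have "card {z. (c a, z) \<in> le (comp R i (c k)) \<and> z \<noteq> c a} = l - a" if a: "a \<le> l" for a
  proof -
    have "{z. (c a, z) \<in> le (comp R i (c k)) \<and> z \<noteq> c a} = c ` {Suc a..l}"
    proof (intro equalityI subsetI)
      fix z assume "z \<in> {z. (c a, z) \<in> le (comp R i (c k)) \<and> z \<noteq> c a}"
      then obtain a' b where "c a = c a'" "z = c b" "a' \<le> b" "b \<le> l" "z \<noteq> c a"
        unfolding string_le[OF S k] by blast
      moreover from this have "a = a'" using inj a by (auto simp: inj_on_def)
      ultimately have "a < b" by (metis le_neq_implies_less)
      then show "z \<in> c ` {Suc a..l}" using \<open>z = c b\<close> \<open>b \<le> l\<close> by auto
    next
      fix z assume "z \<in> c ` {Suc a..l}"
      then obtain b where b: "a < b" "b \<le> l" "z = c b" by (metis Suc_le_eq atLeastAtMost_iff imageE)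
      moreover from this have "c b \<noteq> c a" using inj a by (auto dest: inj_onD)
      ultimately show "z \<in> {z. (c a, z) \<in> le (comp R i (c k)) \<and> z \<noteq> c a}"
        unfolding string_le[OF S k] by simp (metis less_imp_le)
    qed
    moreover have "inj_on c {Suc a..l}" by (rule inj_on_subset[OF inj]) auto
    ultimately show ?thesis by (simp add: card_image)
  qed
  then show ?thesis
    unfolding topmost_def string_verts[OF S k] using string_rk_len(3)[OF S] by auto
qed

text \<open>A rank function of all of \<open>R\<close> grows by one along each arc of the component.
  By linearity a path of arcs joins a vertex \<open>a\<close> of least rank to a vertex
  \<open>b\<close> of greatest rank. It meets every rank in between, and comparable vertices of
  equal rank coincide, so the path exhausts the component.\<close>

lemma fibrous_string:
  assumes F: "fibrous I R" and i: "i \<in> I" and x: "x \<in> verts R"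
  obtains c l k where "color_string R i c l" "k \<le> l" "x = c k"
proof -
  define Q where "Q = comp R i x"
  define A where "A = verts Q"
  obtain \<rho> m where "rank_function R \<rho> m" using F by (auto simp: fibrous_def ranked_def)
  moreover have EQ: "edges Q \<subseteq> {(s, j, t) \<in> edges R. j = i}"
    by (auto simp: Q_def comp_def component_def Let_def)
  ultimately have rank: "\<rho> t = Suc (\<rho> s)" if "(s, t) \<in> arcs Q" for s t
    using that by (fastforce simp: rank_function_def arcs_def)
  have fin: "finite (verts R)" and EV: "edges R \<subseteq> verts R \<times> I \<times> verts R"
    using F by (auto simp: fibrous_def colored_poset_def)
  have AV: "A \<subseteq> verts R" by (auto simp: A_def Q_def comp_def component_def Let_def)
  then have finA: "finite A" using fin finite_subset by blast
  have xA: "x \<in> A" using x by (auto simp: A_def Q_def comp_def component_def Let_def)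
  have cl: "(s, i, t) \<in> edges Q" if "(s, i, t) \<in> edges R" "s \<in> A \<or> t \<in> A" for s t
    using that EV unfolding A_def Q_def comp_def component_def
    by (auto simp: Let_def arcs_def intro: rtrancl_into_rtrancl)
  have EA: "s \<in> A \<and> t \<in> A" if "(s, t) \<in> arcs Q" for s t
    using that by (auto simp: A_def Q_def comp_def component_def Let_def arcs_def)
  have lin: "linear_order_on A (le Q)" using F i x by (simp add: fibrous_def A_def Q_def)
  have comparable: "(s, t) \<in> (arcs Q)\<^sup>* \<or> (t, s) \<in> (arcs Q)\<^sup>*" if "s \<in> A" "t \<in> A" for s t
    using lin that by (cases "s = t") (auto simp: linear_order_on_def total_on_def le_def)
  have mono: "s = t \<or> \<rho> s < \<rho> t" if "(s, t) \<in> (arcs Q)\<^sup>*" for s t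
    using that by induction (auto dest: rank)
  obtain a where a: "a \<in> A" "\<And>y. y \<in> A \<Longrightarrow> \<rho> a \<le> \<rho> y"
    using ex_min_if_finite[of "\<rho> ` A"] finA xA by (metis (mono_tags) arg_min_if_finite(1) arg_min_least empty_iff)
  obtain b where b: "b \<in> A" "\<And>y. y \<in> A \<Longrightarrow> \<rho> y \<le> \<rho> b"
    using Max_in[of "\<rho> ` A"] Max_ge[of "\<rho> ` A"] finA xA
    by (metis (no_types, lifting) empty_iff finite_imageI image_iff image_eqI)
  have "(a, b) \<in> (arcs Q)\<^sup>*" using comparable[OF a(1) b(1)] mono a b by (metis leD)
  then obtain l where "(a, b) \<in> arcs Q ^^ l" using rtrancl_imp_relpow by blast
  then obtain c where c: "c 0 = a" "c l = b" "\<And>k. k < l \<Longrightarrow> (c k, c (Suc k)) \<in> arcs Q"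
    by (auto simp: relpow_fun_conv)
  have rc: "k \<le> l \<Longrightarrow> \<rho> (c k) = \<rho> a + k" for k
    by (induction k) (use c(1) rank[OF c(3)] in auto)
  have cA: "c k \<in> A" if "k \<le> l" for k
    using that a(1) c EA by (cases k) (auto simp: Suc_le_eq)
  have onto: "y = c (\<rho> y - \<rho> a) \<and> \<rho> y - \<rho> a \<le> l" if y: "y \<in> A" for y
  proof -
    have "\<rho> y - \<rho> a \<le> l" using b(2)[OF y] rc[of l] c(2) by simp
    moreover from this have "\<rho> (c (\<rho> y - \<rho> a)) = \<rho> y" using rc a(2)[OF y] by simp
    ultimately show ?thesis using comparable[OF y cA] mono by (metis less_irrefl)
  qed
  have "color_string R i c l"
    unfolding color_string_def
  proof (intro conjI allI impI)
    show "inj_on c {0..l}" using rc by (intro inj_onI) (metis add_left_cancel atLeastAtMost_iff)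
    show "c ` {0..l} \<subseteq> verts R" using cA AV by auto
    show "(c k, i, c (Suc k)) \<in> edges R" if "k < l" for k
      using c(3)[OF that] EQ by (auto simp: arcs_def)
    show "\<exists>k<l. s = c k \<and> t = c (Suc k)"
      if "(s, i, t) \<in> edges R" "s \<in> c ` {0..l} \<or> t \<in> c ` {0..l}" for s t
    proof -
      have "(s, i, t) \<in> edges Q" using that cA by (intro cl) auto
      then have st: "(s, t) \<in> arcs Q" by (auto simp: arcs_def)
      then have "s \<in> A" "t \<in> A" using EA by auto
      with rank[OF st] a(2)[of s] onto[of s] onto[of t] show ?thesis
        by (intro exI[of _ "\<rho> s - \<rho> a"]) (auto simp: Suc_diff_le)
    qed
  qed
  with onto[OF xA] that show thesis by blast
qed

section \<open>Strings in disjoint sums and in the crystal product\<close>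

lemma component_closed:
  assumes E: "(s, i, t) \<in> edges P" and V: "s \<in> verts P" "t \<in> verts P"
    and C: "D \<in> components P"
  shows "s \<in> verts D \<longleftrightarrow> t \<in> verts D"
proof -
  have "(s, t) \<in> arcs P \<union> (arcs P)\<inverse>" "(t, s) \<in> arcs P \<union> (arcs P)\<inverse>"
    using E by (auto simp: arcs_def)
  then show ?thesis
    using V C by (auto simp: components_def component_def Let_def intro: rtrancl_into_rtrancl)
qed

text \<open>An edge never leaves a connected component, so one vertex of a string carries the whole
  string into a single summand. The sum has only edges of \<open>P\<close>, so closedness
  persists.\<close>

lemma disjoint_sum_string:
  assumes S: "color_string P i c l" and C: "\<C> \<subseteq> components P"
    and k: "k \<le> l" "c k \<in> verts (disjoint_sum \<C>)"
  shows "color_string (disjoint_sum \<C>) i c l"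
proof -
  have V: "c ` {0..l} \<subseteq> verts P" and edge: "\<And>k. k < l \<Longrightarrow> (c k, i, c (Suc k)) \<in> edges P"
    using S by (auto simp: color_string_def)
  obtain D where D: "D \<in> \<C>" "c k \<in> verts D" using k by (auto simp: disjoint_sum_def)
  have step: "c j \<in> verts D \<longleftrightarrow> c (Suc j) \<in> verts D" if "j < l" for j
    using that V C D by (intro component_closed[OF edge]) auto
  have "j \<le> l \<Longrightarrow> c j \<in> verts D \<longleftrightarrow> c 0 \<in> verts D" for j
    by (induction j) (use step in auto)
  then have cD: "c j \<in> verts D" if "j \<le> l" for j
    using that D k by metis
  have "(c j, i, c (Suc j)) \<in> edges D" if "j < l" for j
    using cD[of j] cD[of "Suc j"] edge[OF that] that C D
    by (auto simp: components_def component_def Let_def)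
  moreover have "edges (disjoint_sum \<C>) \<subseteq> edges P"
    using C by (auto simp: disjoint_sum_def components_def component_def Let_def)
  ultimately show ?thesis
    using S D(1) cD unfolding color_string_def by (auto simp: disjoint_sum_def)
qed

text \<open>
  Going up the string, the second coordinate first rises along the string of \<open>R2\<close> up to \<open>c2 q\<close>,
  the point where its depth equals the rank of the first coordinate; only then does the first
  coordinate rise, and it rises to the top.
\<close>

lemma product_string:
  assumes S1: "color_string R1 i c1 l1" and S2: "color_string R2 i c2 l2"
    and pq: "p + q = l2" "p \<le> l1"
  defines "c \<equiv> \<lambda>k. if k \<le> q then (c1 p, c2 k) else (c1 (p + (k - q)), c2 q)"
  shows "color_string (crystal_product R1 R2) i c (q + (l1 - p))"
proof -
  let ?l = "q + (l1 - p)" and ?P = "crystal_product R1 R2"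
  have E1: "k < l1 \<Longrightarrow> (c1 k, i, c1 (Suc k)) \<in> edges R1"
    and C1: "(s, i, t) \<in> edges R1 \<Longrightarrow> s \<in> c1 ` {0..l1} \<or> t \<in> c1 ` {0..l1} \<Longrightarrow>
      \<exists>k<l1. s = c1 k \<and> t = c1 (Suc k)" for s t k
    using S1 unfolding color_string_def by blast+
  have E2: "k < l2 \<Longrightarrow> (c2 k, i, c2 (Suc k)) \<in> edges R2"
    and C2: "(s, i, t) \<in> edges R2 \<Longrightarrow> s \<in> c2 ` {0..l2} \<or> t \<in> c2 ` {0..l2} \<Longrightarrow>
      \<exists>k<l2. s = c2 k \<and> t = c2 (Suc k)" for s t k
    using S2 unfolding color_string_def by blast+
  have V1: "c1 a \<in> verts R1" if "a \<le> l1" for a using S1 that by (auto simp: color_string_def)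
  have V2: "c2 a \<in> verts R2" if "a \<le> l2" for a using S2 that by (auto simp: color_string_def)
  have I1: "c1 a = c1 b \<longleftrightarrow> a = b" if "a \<le> l1" "b \<le> l1" for a b
    using S1 that by (auto simp: color_string_def inj_on_def)
  have I2: "c2 a = c2 b \<longleftrightarrow> a = b" if "a \<le> l2" "b \<le> l2" for a b
    using S2 that by (auto simp: color_string_def inj_on_def)
  note rk1 = string_rk_len(1)[OF S1] and depth2 = string_rk_len(3)[OF S2]
  have im: "c ` {0..?l} = {(c1 p, c2 k) | k. k \<le> q} \<union> {(c1 k, c2 q) | k. p \<le> k \<and> k \<le> l1}"
  proof (intro equalityI subsetI)
    fix y assume "y \<in> c ` {0..?l}"
    then obtain k where "k \<le> ?l" "y = c k" by auto
    then show "y \<in> {(c1 p, c2 k) | k. k \<le> q} \<union> {(c1 k, c2 q) | k. p \<le> k \<and> k \<le> l1}"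
      using pq by (cases "k \<le> q") (auto simp: c_def)
  next
    fix y assume "y \<in> {(c1 p, c2 k) | k. k \<le> q} \<union> {(c1 k, c2 q) | k. p \<le> k \<and> k \<le> l1}"
    then consider k where "k \<le> q" "y = (c1 p, c2 k)" | k where "p \<le> k" "k \<le> l1" "y = (c1 k, c2 q)"
      by blast
    then show "y \<in> c ` {0..?l}"
    proof cases
      case 1 then show ?thesis by (auto simp: c_def intro!: image_eqI[of _ _ k])
    next
      \<comment> \<open>The corner \<open>(c1 p, c2 q)\<close> has index \<open>q\<close> and falls
        under the first branch of \<open>c\<close>; both branches agree there.\<close>
      case 2 then show ?thesis by (cases "k = p") (auto simp: c_def intro!: image_eqI[of _ _ "q + (k - p)"])
    qed
  qed
  show ?thesis
    unfolding color_string_def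
  proof (intro conjI allI impI)
    show "inj_on c {0..?l}"
      using pq by (intro inj_onI) (auto simp: c_def I1 I2 split: if_splits)
    show "c ` {0..?l} \<subseteq> verts ?P"
      unfolding im using pq V1 V2 by (auto simp: crystal_product_def)
  next
    fix k assume k: "k < ?l"
    show "(c k, i, c (Suc k)) \<in> edges ?P"
    proof (cases "k < q")
      case True
      then have "(c2 k, i, c2 (Suc k)) \<in> edges R2" using E2 pq by simp
      then show ?thesis using True pq V1 V2
        by (auto simp: c_def crystal_product_def rk1 depth2)
    next
      case False
      then have "(c1 (p + (k - q)), i, c1 (Suc (p + (k - q)))) \<in> edges R1"
        using pq k by (intro E1) auto
      then show ?thesis using False pq V1 V2 k
        by (cases "k = q") (auto simp: c_def crystal_product_def rk1 depth2 Suc_diff_le)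
    qed
  next
    fix s t assume st: "(s, i, t) \<in> edges ?P" "s \<in> c ` {0..?l} \<or> t \<in> c ` {0..?l}"
    obtain s1 s2 t1 t2 where eq: "s = (s1, s2)" "t = (t1, t2)" by (metis surj_pair)
    consider (left) "(s1, i, t1) \<in> edges R1" "s2 = t2" "rk R1 i s1 \<ge> depth R2 i s2"
      | (right) "s1 = t1" "(s2, i, t2) \<in> edges R2" "rk R1 i s1 < depth R2 i s2"
      using st(1) by (auto simp: eq crystal_product_def)
    then show "\<exists>k<?l. s = c k \<and> t = c (Suc k)"
    proof cases
      case left
      have "s1 \<in> c1 ` {0..l1} \<or> t1 \<in> c1 ` {0..l1}"
        using st(2) pq unfolding im eq by auto
      then obtain k where k: "k < l1" "s1 = c1 k" "t1 = c1 (Suc k)" using C1 left by blast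
      obtain m where m: "m \<le> q" "s2 = c2 m" using st(2) left unfolding im eq by auto
      \<comment> \<open>The product rule in terms of indices. As \<open>m \<le> q\<close> and
        \<open>p + q = l2\<close>, it gives \<open>k \<ge> p\<close>; an edge touching the string
        must then start on its upper leg, with \<open>m = q\<close>.\<close>
      have "l2 - m \<le> k" using left(3) k(1) m(1) pq(1) unfolding k(2) m(2) by (simp add: rk1 depth2)
      moreover from this have "k \<ge> p" using m pq by simp
      moreover have "m = q"
        using st(2) k m pq left(2) \<open>k \<ge> p\<close> \<open>l2 - m \<le> k\<close> unfolding im eq by (auto simp: I1 I2)
      ultimately show ?thesis using k m left pq
        by (cases "k = p"; intro exI[of _ "q + (k - p)"]) (auto simp: c_def eq Suc_diff_le)
    next
      case right
      have "s2 \<in> c2 ` {0..l2} \<or> t2 \<in> c2 ` {0..l2}"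
        using st(2) pq unfolding im eq by auto
      then obtain k where k: "k < l2" "s2 = c2 k" "t2 = c2 (Suc k)" using C2 right by blast
      obtain m where m: "p \<le> m" "m \<le> l1" "s1 = c1 m" using st(2) right pq unfolding im eq by auto
      \<comment> \<open>Dually, \<open>p \<le> m\<close> gives \<open>k < q\<close>, so the edge
        lies on the lower leg, with \<open>m = p\<close>; the extreme case is the edge ending at the
        corner.\<close>
      have "m < l2 - k" using right(3) k(1) m(2) unfolding k(2) m(3) by (simp add: rk1 depth2)
      moreover from this have "k < q" using m pq by simp
      moreover have "m = p"
        using st(2) k m pq right(1) \<open>k < q\<close> \<open>m < l2 - k\<close> unfolding im eq by (auto simp: I1 I2)
      ultimately show ?thesis using k m right pq
        by (intro exI[of _ k]) (auto simp: c_def eq)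
    qed
  qed
qed

text \<open>Puts a given vertex on an explicit string of the sum, with all data as indices, so that
  the facts below reduce to arithmetic.\<close>

lemma product_component_string:
  assumes F: "fibrous I R1" "fibrous I R2" and i: "i \<in> I"
    and C: "\<C> \<subseteq> components (crystal_product R1 R2)"
    and x: "(x1, x2) \<in> verts (disjoint_sum \<C>)"
  obtains c1 l1 r1 c2 l2 r2 p q where
    "color_string R1 i c1 l1" "r1 \<le> l1" "x1 = c1 r1"
    "color_string R2 i c2 l2" "r2 \<le> l2" "x2 = c2 r2"
    "p = min r1 (l2 - r2)" "q = l2 - p"
    "color_string (disjoint_sum \<C>) i
       (\<lambda>k. if k \<le> q then (c1 p, c2 k) else (c1 (p + (k - q)), c2 q)) (q + (l1 - p))"
    "(x1, x2) = (\<lambda>k. if k \<le> q then (c1 p, c2 k) else (c1 (p + (k - q)), c2 q)) (r2 + (r1 - p))"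
    "r2 + (r1 - p) \<le> q + (l1 - p)"
proof -
  have xV: "x1 \<in> verts R1" "x2 \<in> verts R2"
    using x C by (auto simp: disjoint_sum_def components_def component_def Let_def crystal_product_def)
  obtain c1 l1 r1 where S1: "color_string R1 i c1 l1" "r1 \<le> l1" "x1 = c1 r1"
    using fibrous_string[OF F(1) i xV(1)] .
  obtain c2 l2 r2 where S2: "color_string R2 i c2 l2" "r2 \<le> l2" "x2 = c2 r2"
    using fibrous_string[OF F(2) i xV(2)] .
  \<comment> \<open>If \<open>r1 \<le> l2 - r2\<close>, the vertex is on the lower leg, where the
    first coordinate is constant, so \<open>p = r1\<close>. Otherwise it is on the upper leg, where
    \<open>q = r2\<close> and thus \<open>p = l2 - r2\<close>.\<close>
  define p where "p = min r1 (l2 - r2)"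
  define q where "q = l2 - p"
  define c where "c = (\<lambda>k. if k \<le> q then (c1 p, c2 k) else (c1 (p + (k - q)), c2 q))"
  have "p + q = l2" "p \<le> l1" using S1(2) by (auto simp: p_def q_def)
  then have S: "color_string (crystal_product R1 R2) i c (q + (l1 - p))"
    unfolding c_def by (rule product_string[OF S1(1) S2(1)])
  have xc: "(x1, x2) = c (r2 + (r1 - p))"
    using S1 S2 by (auto simp: c_def p_def q_def min_def)
  have k: "r2 + (r1 - p) \<le> q + (l1 - p)" using S1(2) S2(2) by (auto simp: p_def q_def)
  have "color_string (disjoint_sum \<C>) i c (q + (l1 - p))"
    using disjoint_sum_string[OF S C k] x xc by simp
  then show thesis
    using that[OF S1 S2 p_def q_def] xc k unfolding c_def by blast
qed

text \<open>Truncated subtraction supplies the maximum with zero; the second summand vanishes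
  exactly from the corner upwards.\<close>

lemma depth_product:
  assumes "fibrous I R1" "fibrous I R2" and "i \<in> I"
    and "\<C> \<subseteq> components (crystal_product R1 R2)"
    and "(x1, x2) \<in> verts (disjoint_sum \<C>)"
  shows "depth (disjoint_sum \<C>) i (x1, x2) = depth R1 i x1 + (depth R2 i x2 - rk R1 i x1)"
proof -
  obtain c1 l1 r1 c2 l2 r2 p q where
    S1: "color_string R1 i c1 l1" "r1 \<le> l1" "x1 = c1 r1" and
    S2: "color_string R2 i c2 l2" "r2 \<le> l2" "x2 = c2 r2" and
    pq: "p = min r1 (l2 - r2)" "q = l2 - p" and
    S: "color_string (disjoint_sum \<C>) i
       (\<lambda>k. if k \<le> q then (c1 p, c2 k) else (c1 (p + (k - q)), c2 q)) (q + (l1 - p))" and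
    x: "(x1, x2) = (\<lambda>k. if k \<le> q then (c1 p, c2 k) else (c1 (p + (k - q)), c2 q)) (r2 + (r1 - p))" and
    k: "r2 + (r1 - p) \<le> q + (l1 - p)"
    using product_component_string[OF assms] .
  have "depth (disjoint_sum \<C>) i (x1, x2) = q + (l1 - p) - (r2 + (r1 - p))"
    unfolding x by (rule string_rk_len(3)[OF S k])
  then show ?thesis
    using S1(2) S2(2) unfolding pq
    by (auto simp: S1(3) S2(3) string_rk_len[OF S1(1,2)] string_rk_len[OF S2(1,2)])
qed

text \<open>From the corner upwards the depth in the sum is that of the first coordinate; below it
  the first coordinate is the lowest one on the string, hence has the largest depth. The fourth
  claim serves \<open>x1\<close> outside \<open>\<M>\<close>. The fifth, for \<open>x\<close>
  strictly below the corner, serves \<open>x1\<close> in \<open>\<M>\<close>.\<close>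

lemma comp_product:
  assumes "fibrous I R1" "fibrous I R2" and "i \<in> I"
    and "\<C> \<subseteq> components (crystal_product R1 R2)"
    and "(x1, x2) \<in> verts (disjoint_sum \<C>)"
    and y: "(y1, y2) \<in> verts (comp (disjoint_sum \<C>) i (x1, x2))"
  shows "(y1, y2) \<in> verts (disjoint_sum \<C>)"
    and "y1 \<in> verts (comp R1 i x1)" and "y2 \<in> verts (comp R2 i x2)"
    and "depth (disjoint_sum \<C>) i (y1, y2) = depth R1 i y1 \<or> depth R1 i x1 \<le> depth R1 i y1"
    and "rk R1 i x1 < depth R2 i x2 \<Longrightarrow> y1 = x1 \<or>
      depth (disjoint_sum \<C>) i (y1, y2) = depth R1 i y1 \<and> depth R1 i y1 \<le> depth R1 i x1"
proof -
  obtain c1 l1 r1 c2 l2 r2 p q where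
    S1: "color_string R1 i c1 l1" "r1 \<le> l1" "x1 = c1 r1" and
    S2: "color_string R2 i c2 l2" "r2 \<le> l2" "x2 = c2 r2" and
    pq: "p = min r1 (l2 - r2)" "q = l2 - p" and
    S: "color_string (disjoint_sum \<C>) i
       (\<lambda>k. if k \<le> q then (c1 p, c2 k) else (c1 (p + (k - q)), c2 q)) (q + (l1 - p))"
       (is "color_string _ _ ?c ?l") and
    x: "(x1, x2) = (\<lambda>k. if k \<le> q then (c1 p, c2 k) else (c1 (p + (k - q)), c2 q)) (r2 + (r1 - p))" and
    k: "r2 + (r1 - p) \<le> q + (l1 - p)"
    using product_component_string[OF assms(1-5)] .
  have "verts (comp (disjoint_sum \<C>) i (x1, x2)) = ?c ` {0..?l}"
    unfolding x by (rule string_verts[OF S k])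
  with y have "(y1, y2) \<in> ?c ` {0..?l}" by simp
  then obtain m where "m \<in> {0..?l}" and "(y1, y2) = ?c m" by (rule imageE)
  then have m: "m \<le> ?l" "(y1, y2) = ?c m" by simp_all
  show "(y1, y2) \<in> verts (disjoint_sum \<C>)"
    using y by (simp add: comp_def component_def Let_def)
  have d: "depth (disjoint_sum \<C>) i (y1, y2) = ?l - m"
    unfolding m(2) by (rule string_rk_len(3)[OF S m(1)])
  have pr: "p \<le> r1" and pl: "p \<le> l1" using S1(2) pq by simp_all
  obtain a where a: "a \<le> l1" "y1 = c1 a" "m \<le> q \<and> a = p \<or> a = p + (m - q) \<and> q < m"
    using m pl by (cases "m \<le> q") auto
  obtain b where b: "b \<le> l2" "y2 = c2 b"
  proof
    show "min m q \<le> l2" using pq by simp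
    show "y2 = c2 (min m q)" using m by (cases "m \<le> q") auto
  qed
  show "y1 \<in> verts (comp R1 i x1)" "y2 \<in> verts (comp R2 i x2)"
    using a b by (auto simp: S1(3) S2(3) string_verts[OF S1(1,2)] string_verts[OF S2(1,2)])
  have dy: "depth R1 i y1 = l1 - a" using a string_rk_len(3)[OF S1(1)] by simp
  have dx: "depth R1 i x1 = l1 - r1" "rk R1 i x1 = r1" "depth R2 i x2 = l2 - r2"
    using string_rk_len[OF S1(1,2)] string_rk_len[OF S2(1,2)] S1(3) S2(3) by auto
  show "depth (disjoint_sum \<C>) i (y1, y2) = depth R1 i y1 \<or> depth R1 i x1 \<le> depth R1 i y1"
    using a(3) pr m(1) pl unfolding d dy dx by arith
  show "y1 = x1 \<or> depth (disjoint_sum \<C>) i (y1, y2) = depth R1 i y1 \<and> depth R1 i y1 \<le> depth R1 i x1"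
    if "rk R1 i x1 < depth R2 i x2"
  proof -
    have "p = r1" using that pq(1) unfolding dx by simp
    then show ?thesis using a(2,3) m(1) pl S1(3) unfolding d dy dx by auto
  qed
qed

section \<open>Depth criteria for colorings and primarity\<close>

lemma same_comp:
  assumes "fibrous I R" and "i \<in> I" and "x \<in> verts R" and "y \<in> verts (comp R i x)"
  shows "len R i y = len R i x" and "depth R i y = depth R i x \<Longrightarrow> y = x"
    and "rk R i x + depth R i x = len R i x"
proof -
  obtain c l k where S: "color_string R i c l" "k \<le> l" "x = c k"
    using fibrous_string[OF assms(1-3)] .
  obtain m where m: "m \<le> l" "y = c m"
    using assms(4) string_verts[OF S(1,2)] S(3) by auto
  show "len R i y = len R i x" "depth R i y = depth R i x \<Longrightarrow> y = x"
    "rk R i x + depth R i x = len R i x"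
    using S(2,3) m string_rk_len[OF S(1)] diff_diff_cancel[of k l] diff_diff_cancel[of m l] by auto
qed

text \<open>Outside the topmost \<open>1 + p\<close> vertices the depth exceeds \<open>p\<close>, so
  the set equation becomes a pointwise test. The hypothesis is phrased with strings because both
  \<open>R1\<close> and the sum supply it in this form.\<close>

lemma coloring_iff_depth:
  assumes "\<forall>i \<in> J. \<forall>x \<in> verts R. \<exists>c l k. color_string R i c l \<and> k \<le> l \<and> x = c k"
  shows "coloring J \<nu> R \<kappa> \<longleftrightarrow>
    (\<forall>x \<in> verts R - \<M> J \<nu> R. \<kappa> x \<in> J \<and>
       (\<forall>y \<in> verts (comp R (\<kappa> x) x).
          y \<notin> \<M> J \<nu> R \<and> \<kappa> y = \<kappa> x \<longleftrightarrow> \<nu> (\<kappa> x) < depth R (\<kappa> x) y))"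
proof -
  have "topmost R i x p = {y \<in> verts (comp R i x). depth R i y \<le> p}"
    if "i \<in> J" "x \<in> verts R" for i x p
  proof -
    have "\<exists>c l k. color_string R i c l \<and> k \<le> l \<and> x = c k"
      using assms \<open>i \<in> J\<close> \<open>x \<in> verts R\<close> by blast
    then obtain c l k where S: "color_string R i c l" "k \<le> l" "x = c k" by blast
    show ?thesis unfolding S(3) string_topmost[OF S(1,2)] string_verts[OF S(1,2)] ..
  qed
  then show ?thesis
    unfolding coloring_def by (intro ball_cong refl conj_cong) (auto simp: set_eq_iff not_le)
qed

text \<open>Positive depth means that \<open>x\<close> is not the top of its
  \<open>i\<close>-string, which is the range \<open>k \<le> l - 1\<close> constrained by
  \<open>primary\<close>.\<close>

lemma primary_depth:
  assumes P: "primary I R" and x: "x \<in> verts R" and ij: "i \<in> I" "j \<in> I" "j \<noteq> i"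
    and "2 \<le> len R i x" "0 < depth R i x" "2 \<le> len R j x"
  shows "depth R j x = 0"
proof -
  have "fibrous I R" using P by (simp add: primary_def)
  then obtain c l k where S: "color_string R i c l" "k \<le> l" "x = c k"
    using fibrous_string ij(1) x by metis
  with assms have "2 \<le> l" "k \<le> l - 1" using string_rk_len[OF S(1,2)] by auto
  moreover have "comp R i x = \<lparr>verts = c ` {0..l}, edges = {(c k, i, c (Suc k)) | k. k < l}\<rparr>"
    using comp_string[OF S(1,2)] S(3) by simp
  ultimately have "2 \<le> len R j (c k) \<longrightarrow> depth R j (c k) = 0"
    using P x ij unfolding primary_def by blast
  then show ?thesis using assms(8) S(3) by simp
qed

text \<open>
  For a color in \<open>\<K>\<close> the value \<open>rk R2 i x2\<close> in \<open>reach\<close> matters only when the other term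
  of the maximum is already at least \<open>2\<close>, so whether \<open>reach\<close> is at least \<open>2\<close> is constant along
  the string of \<open>x2\<close>.
\<close>

lemma reach_ge_2_iff:
  assumes "fibrous I R2" "i \<in> I" "x2 \<in> verts R2" and "rk R1 i x1 < depth R2 i x2"
  shows "2 \<le> reach R1 R2 x1 x2 i \<longleftrightarrow> rk R1 i x1 + 2 \<le> len R2 i x2"
proof -
  have "x2 \<in> verts (comp R2 i x2)"
    using assms(3) by (auto simp: comp_def component_def Let_def)
  from same_comp(3)[OF assms(1-3) this] assms(4) show ?thesis
    by (auto simp: reach_def max_def)
qed

section \<open>The induced coloring of the product\<close>

theorem theorem5p13:
  fixes I J :: "'i set" and \<nu> :: "'i \<Rightarrow> nat"
    and R1 :: "('a, 'i) cposet" and R2 :: "('b, 'i) cposet"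
    and R :: "('a \<times> 'b, 'i) cposet" and \<C> :: "('a \<times> 'b, 'i) cposet set"
    and \<kappa>1 :: "'a \<Rightarrow> 'i"
  assumes "fibrous I R1" and "fibrous I R2" and "primary I R2"
    and "J \<subseteq> I"
    and "\<C> \<subseteq> components (crystal_product R1 R2)" and "R = disjoint_sum \<C>"
    and "coloring J \<nu> R1 \<kappa>1"
  shows
    "(\<forall>x1 x2. (x1, x2) \<in> verts R - \<M> J \<nu> R \<longrightarrow>
       (let c1 = (x1 \<notin> \<M> J \<nu> R1);
            c2 = (x1 \<in> \<M> J \<nu> R1 \<and> (\<exists>!j. j \<in> \<K> J \<nu> R (x1, x2) \<and> reach R1 R2 x1 x2 j \<ge> 2));
            c3 = (x1 \<in> \<M> J \<nu> R1 \<and> (\<forall>i \<in> \<K> J \<nu> R (x1, x2). reach R1 R2 x1 x2 i \<le> 1))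
        in (c1 \<and> \<not> c2 \<and> \<not> c3) \<or> (\<not> c1 \<and> c2 \<and> \<not> c3) \<or> (\<not> c1 \<and> \<not> c2 \<and> c3)))
     \<and>
     (\<forall>\<kappa> :: 'a \<times> 'b \<Rightarrow> 'i.
       (\<forall>x1 x2. (x1, x2) \<in> verts R - \<M> J \<nu> R \<longrightarrow>
          (x1 \<notin> \<M> J \<nu> R1 \<longrightarrow> \<kappa> (x1, x2) = \<kappa>1 x1) \<and>
          (x1 \<in> \<M> J \<nu> R1 \<and> (\<exists>!j. j \<in> \<K> J \<nu> R (x1, x2) \<and> reach R1 R2 x1 x2 j \<ge> 2) \<longrightarrow>
             \<kappa> (x1, x2) = (THE j. j \<in> \<K> J \<nu> R (x1, x2) \<and> reach R1 R2 x1 x2 j \<ge> 2)) \<and>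
          (x1 \<in> \<M> J \<nu> R1 \<and> (\<forall>i \<in> \<K> J \<nu> R (x1, x2). reach R1 R2 x1 x2 i \<le> 1) \<longrightarrow>
             \<kappa> (x1, x2) \<in> \<K> J \<nu> R (x1, x2)))
       \<longrightarrow> coloring J \<nu> R \<kappa>)"
proof -
  let ?M1 = "\<M> J \<nu> R1" and ?M = "\<M> J \<nu> R" and ?K = "\<lambda>x. \<K> J \<nu> R x"
    and ?reach = "reach R1 R2"
  note F1 = assms(1) and F2 = assms(2) and P = assms(3) and JI = assms(4) and C = assms(5)
  note R = assms(6)
  have xV: "x1 \<in> verts R1" "x2 \<in> verts R2" if "(x1, x2) \<in> verts R" for x1 x2
    using that C by (auto simp: R disjoint_sum_def components_def component_def Let_def crystal_product_def)
  note depth_R = depth_product[OF F1 F2 _ C, folded R]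
  note comp_R = comp_product[OF F1 F2 _ C, folded R]
  have str: "\<forall>i \<in> J. \<forall>x \<in> verts R. \<exists>c l k. color_string R i c l \<and> k \<le> l \<and> x = c k"
  proof (intro ballI)
    fix i x assume ix: "i \<in> J" "x \<in> verts R"
    obtain x1 x2 where eq: "x = (x1, x2)" by fastforce
    have "i \<in> I" "(x1, x2) \<in> verts (disjoint_sum \<C>)" using ix JI eq R by auto
    from product_component_string[OF F1 F2 this(1) C this(2)]
    show "\<exists>c l k. color_string R i c l \<and> k \<le> l \<and> x = c k"
      unfolding R eq by blast
  qed
  have str1: "\<forall>i \<in> J. \<forall>x \<in> verts R1. \<exists>c l k. color_string R1 i c l \<and> k \<le> l \<and> x = c k"
    using JI by (blast elim: fibrous_string[OF F1])
  have col1: "\<kappa>1 x \<in> J" "\<And>y. y \<in> verts (comp R1 (\<kappa>1 x) x) \<Longrightarrow>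
      y \<notin> ?M1 \<and> \<kappa>1 y = \<kappa>1 x \<longleftrightarrow> \<nu> (\<kappa>1 x) < depth R1 (\<kappa>1 x) y"
    if "x \<in> verts R1" "x \<notin> ?M1" for x
    using assms(7)[unfolded coloring_iff_depth[OF str1]] that by blast+
  have self: "x \<in> verts (comp T i x)" if "x \<in> verts T" for x i and T :: "('c, 'i) cposet"
    using that by (auto simp: comp_def component_def Let_def)
  \<comment> \<open>With \<open>x1\<close> in \<open>\<M>\<close>, the first summand of the product
    depth is at most \<open>\<nu> i\<close>, so the excess comes from a positive second
    summand.\<close>
  have K: "i \<in> J" "depth R1 i x1 \<le> \<nu> i" "rk R1 i x1 < depth R2 i x2"
    if "(x1, x2) \<in> verts R" "x1 \<in> ?M1" "i \<in> ?K (x1, x2)" for x1 x2 i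
  proof -
    show i: "i \<in> J" using that by (simp add: \<K>_def)
    then show d: "depth R1 i x1 \<le> \<nu> i" using that by (simp add: \<M>_def)
    have "\<nu> i < depth R i (x1, x2)" using that by (simp add: \<K>_def)
    also have "\<dots> = depth R1 i x1 + (depth R2 i x2 - rk R1 i x1)"
      using depth_R[OF subsetD[OF JI i] that(1)] .
    finally show "rk R1 i x1 < depth R2 i x2" using d by simp
  qed
  have reach: "2 \<le> ?reach x1 x2 i \<longleftrightarrow> rk R1 i x1 + 2 \<le> len R2 i x2"
    if "(x1, x2) \<in> verts R" "x1 \<in> ?M1" "i \<in> ?K (x1, x2)" for x1 x2 i
    by (rule reach_ge_2_iff[OF F2 subsetD[OF JI K(1)[OF that]] xV(2)[OF that(1)] K(3)[OF that]])
  \<comment> \<open>Both colors have length at least \<open>2\<close> and positive depth at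
    \<open>x2\<close>; primarity applied to \<open>i\<close> would make the depth in
    \<open>j\<close> vanish.\<close>
  have unique: "i = j"
    if x: "(x1, x2) \<in> verts R" "x1 \<in> ?M1"
      and i: "i \<in> ?K (x1, x2)" "2 \<le> ?reach x1 x2 i"
      and j: "j \<in> ?K (x1, x2)" "2 \<le> ?reach x1 x2 j" for x1 x2 i j
  proof (rule ccontr)
    assume "i \<noteq> j"
    moreover have "i \<in> I" "j \<in> I" using K(1)[OF x] i j JI by auto
    ultimately have "depth R2 j x2 = 0"
      using primary_depth[OF P xV(2)[OF x(1)], of i j] K(3)[OF x i(1)]
        reach[OF x i(1)] reach[OF x j(1)] i(2) j(2) by simp
    then show False using K(3)[OF x j(1)] by simp
  qed
  \<comment> \<open>By \<open>unique\<close>, existence of a color with \<open>reach\<close> at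
    least \<open>2\<close> already gives unique existence; over the integers this negates the bound
    by \<open>1\<close>.\<close>
  have trichotomy: "(\<exists>!j. j \<in> ?K (x1, x2) \<and> ?reach x1 x2 j \<ge> 2) \<longleftrightarrow>
      \<not> (\<forall>i \<in> ?K (x1, x2). ?reach x1 x2 i \<le> 1)"
    if "(x1, x2) \<in> verts R" "x1 \<in> ?M1" for x1 x2
  proof
    assume "\<not> (\<forall>i \<in> ?K (x1, x2). ?reach x1 x2 i \<le> 1)"
    then obtain i where "i \<in> ?K (x1, x2) \<and> 2 \<le> ?reach x1 x2 i" by force
    then show "\<exists>!j. j \<in> ?K (x1, x2) \<and> ?reach x1 x2 j \<ge> 2"
      using unique[OF that] by (intro ex1I[of _ i]) auto
  qed force
  show ?thesis
  proof (intro conjI allI impI)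
    fix x1 x2 assume "(x1, x2) \<in> verts R - ?M"
    then show "let c1 = (x1 \<notin> \<M> J \<nu> R1);
            c2 = (x1 \<in> \<M> J \<nu> R1 \<and> (\<exists>!j. j \<in> \<K> J \<nu> R (x1, x2) \<and> reach R1 R2 x1 x2 j \<ge> 2));
            c3 = (x1 \<in> \<M> J \<nu> R1 \<and> (\<forall>i \<in> \<K> J \<nu> R (x1, x2). reach R1 R2 x1 x2 i \<le> 1))
        in (c1 \<and> \<not> c2 \<and> \<not> c3) \<or> (\<not> c1 \<and> c2 \<and> \<not> c3) \<or> (\<not> c1 \<and> \<not> c2 \<and> c3)"
      using trichotomy[of x1 x2] unfolding Let_def by blast
  next
    fix \<kappa> :: "'a \<times> 'b \<Rightarrow> 'i"
    assume \<kappa>: "\<forall>x1 x2. (x1, x2) \<in> verts R - ?M \<longrightarrow>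
          (x1 \<notin> ?M1 \<longrightarrow> \<kappa> (x1, x2) = \<kappa>1 x1) \<and>
          (x1 \<in> ?M1 \<and> (\<exists>!j. j \<in> ?K (x1, x2) \<and> ?reach x1 x2 j \<ge> 2) \<longrightarrow>
             \<kappa> (x1, x2) = (THE j. j \<in> ?K (x1, x2) \<and> ?reach x1 x2 j \<ge> 2)) \<and>
          (x1 \<in> ?M1 \<and> (\<forall>i \<in> ?K (x1, x2). ?reach x1 x2 i \<le> 1) \<longrightarrow>
             \<kappa> (x1, x2) \<in> ?K (x1, x2))"
    have \<kappa>1: "\<kappa> (x1, x2) = \<kappa>1 x1" if "(x1, x2) \<in> verts R - ?M" "x1 \<notin> ?M1" for x1 x2
      using \<kappa> that by blast
    have \<kappa>2: "\<kappa> (x1, x2) = j"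
      if "(x1, x2) \<in> verts R - ?M" "x1 \<in> ?M1" "j \<in> ?K (x1, x2)" "2 \<le> ?reach x1 x2 j" for x1 x2 j
    proof -
      have ex1: "\<exists>!j. j \<in> ?K (x1, x2) \<and> ?reach x1 x2 j \<ge> 2"
        using that(1) by (intro ex1I[of _ j] conjI that(3,4)) (blast intro: unique that(2-4))
      then have "\<kappa> (x1, x2) = (THE j. j \<in> ?K (x1, x2) \<and> ?reach x1 x2 j \<ge> 2)"
        using \<kappa>[rule_format, OF that(1)] that(2) by simp
      also have "\<dots> = j" using ex1 that(3,4) by (intro the1_equality) simp_all
      finally show ?thesis .
    qed
    \<comment> \<open>This settles membership in \<open>J\<close> and the forward half of the depth
      test. For \<open>x1\<close> outside \<open>\<M>\<close>, the coloring of \<open>R1\<close> is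
      applied at \<open>x1\<close> itself, and the product depth is at least that of
      \<open>x1\<close>.\<close>
    have \<kappa>K: "\<kappa> x \<in> ?K x" if x: "x \<in> verts R - ?M" for x
    proof -
      obtain x1 x2 where eq: "x = (x1, x2)" by fastforce
      with x have xR: "(x1, x2) \<in> verts R" by simp
      show ?thesis
      proof (cases "x1 \<in> ?M1")
        case False
        have "\<kappa> x = \<kappa>1 x1" using \<kappa>1 x False eq by simp
        moreover have "\<kappa>1 x1 \<in> J" "\<nu> (\<kappa>1 x1) < depth R1 (\<kappa>1 x1) x1"
          using col1[OF xV(1)[OF xR] False] self[OF xV(1)[OF xR], of "\<kappa>1 x1"] False by auto
        ultimately show ?thesis
          using depth_R[OF subsetD[OF JI \<open>\<kappa>1 x1 \<in> J\<close>] xR] by (simp add: \<K>_def eq)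
      next
        case True
        show ?thesis
        proof (cases "\<forall>i \<in> ?K (x1, x2). ?reach x1 x2 i \<le> 1")
          case True
          with \<kappa>[rule_format, of x1 x2] x \<open>x1 \<in> ?M1\<close> eq show ?thesis by simp
        next
          case False
          then obtain i where "i \<in> ?K (x1, x2)" "2 \<le> ?reach x1 x2 i" by force
          with \<kappa>2[of x1 x2 i] x True eq show ?thesis by simp
        qed
      qed
    qed
    show "coloring J \<nu> R \<kappa>"
      unfolding coloring_iff_depth[OF str]
    proof (intro ballI conjI iffI)
      fix x assume x: "x \<in> verts R - ?M"
      show j: "\<kappa> x \<in> J" using \<kappa>K[OF x] by (simp add: \<K>_def)
      then have jI: "\<kappa> x \<in> I" using JI by blast
      fix y assume y: "y \<in> verts (comp R (\<kappa> x) x)"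
      obtain x1 x2 y1 y2 where eq: "x = (x1, x2)" "y = (y1, y2)" by fastforce
      have xR: "(x1, x2) \<in> verts R" using x eq by simp
      note xV = xV[OF xR]
      note yc = comp_R[OF jI[unfolded eq] xR y[unfolded eq]]
      {
        assume "y \<notin> ?M \<and> \<kappa> y = \<kappa> x"
        then show "\<nu> (\<kappa> x) < depth R (\<kappa> x) y"
          using \<kappa>K[of y] yc(1) eq by (auto simp: \<K>_def)
      }
      assume dy: "\<nu> (\<kappa> x) < depth R (\<kappa> x) y"
      then show yM: "y \<notin> ?M" using j by (auto simp: \<M>_def not_le)
      have yR: "y \<in> verts R - ?M" using yM yc(1) eq by simp
      have yK: "\<kappa> x \<in> ?K y" using dy j by (simp add: \<K>_def)
      show "\<kappa> y = \<kappa> x"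
      proof (cases "x1 \<in> ?M1")
        case False
        have kx: "\<kappa> x = \<kappa>1 x1" using \<kappa>1 x False eq by simp
        have "\<nu> (\<kappa> x) < depth R1 (\<kappa> x) x1"
          using col1(2)[OF xV(1) False self[OF xV(1)]] False kx by simp
        \<comment> \<open>Either the depth of \<open>y\<close> equals that of \<open>y1\<close>, or
          \<open>y1\<close> is at least as deep as \<open>x1\<close>; both exceed the bound.\<close>
        then have "\<nu> (\<kappa> x) < depth R1 (\<kappa> x) y1" using yc(4) dy eq by auto
        then have "y1 \<notin> ?M1" "\<kappa>1 y1 = \<kappa> x"
          using col1(2)[OF xV(1) False] yc(2) kx eq by auto
        then show ?thesis using \<kappa>1 yR eq by simp
      next
        case True
        note Kx = K[OF xR True \<kappa>K[OF x, unfolded eq(1)], folded eq(1)]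
        \<comment> \<open>Otherwise the depth of \<open>y\<close> would be that of
          \<open>y1\<close>, at most that of \<open>x1\<close>, hence at most
          \<open>\<nu> (\<kappa> x)\<close>.\<close>
        have y1: "y1 = x1" using yc(5)[folded eq] Kx(2,3) dy by auto
        have yR': "(x1, y2) \<in> verts R" using yc(1) y1 by simp
        note rx = reach[OF xR True \<kappa>K[OF x, unfolded eq(1)], folded eq(1)]
        note ry = reach[OF yR' True, of "\<kappa> x"]
        note sc = same_comp[OF F2 jI xV(2) yc(3)[folded eq(1)]]
        show ?thesis
        \<comment> \<open>This form of \<open>reach \<ge> 2\<close> involves only \<open>x1\<close>
          and the length of the string of \<open>x2\<close>, so it holds at \<open>x\<close> and
          \<open>y\<close> alike.\<close>
        proof (cases "rk R1 (\<kappa> x) x1 + 2 \<le> len R2 (\<kappa> x) x2")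
          case True
          then show ?thesis
            using \<kappa>2[of x1 y2 "\<kappa> x"] \<open>x1 \<in> ?M1\<close> yR yK y1 eq sc(1) ry by simp
        next
          case False
          \<comment> \<open>Both depths exceed the rank of \<open>x1\<close>, while the length is at
            most one more than that rank. They are therefore equal, which gives
            \<open>y = x\<close>; a free choice of color thus causes no conflict.\<close>
          have "rk R1 (\<kappa> x) x1 < depth R2 (\<kappa> x) y2"
            using K(3)[OF yR' \<open>x1 \<in> ?M1\<close>] yK y1 eq by simp
          moreover have "depth R2 (\<kappa> x) y2 \<le> len R2 (\<kappa> x) y2" by (simp add: depth_def)
          moreover have "depth R2 (\<kappa> x) x2 \<le> len R2 (\<kappa> x) x2" by (simp add: depth_def)
          ultimately have "depth R2 (\<kappa> x) y2 = depth R2 (\<kappa> x) x2"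
            using False Kx(3) sc(1) by simp
          then show ?thesis using sc(2) y1 eq by simp
        qed
      qed
    qed
  qed
qed

end
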